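(* For any ring $R$, the following hold: (1) the polynomial ring $R[x]$ is not $\Delta$-quasipolar; (2) for every $n\geq 2$, the matrix ring $M_n(R)$ of $n\times n$ matrices over $R$ is not $\Delta$-quasipolar.
   Context: All rings are assumed to be unital and associative; $U(S)$ is the group of units of a ring $S$. For a ring $S$, $\Delta(S)=\{r\in S \mid r+u\in U(S)\text{ for all }u\in U(S)\}$. For $a\in S$, $comm(a)=\{x\in S\mid ax=xa\}$ and $comm^2(a)=\{y\in S\mid xy=yx\text{ for all }x\in comm(a)\}$. An element $a\in S$ is $\Delta$-quasipolar if there exists $p^2=p\in comm^2(a)$ such that $a+p\in\Delta(S)$; $S$ is $\Delta$-quasipolar if every element of $S$ is $\Delta$-quasipolar.
   Formalization: The ring R is assumed to be nonzero (1 ≠ 0); for the zero ring, R[x] and M_n(R) are zero rings, which are Δ-quasipolar, so the claim fails there. *)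

theory Defs
  imports "Jordan_Normal_Form.Matrix" "HOL-Algebra.UnivPoly"
begin

definition Delta :: "('a, 'm) ring_scheme \<Rightarrow> 'a set" where
  "Delta S = {r \<in> carrier S. \<forall>u \<in> Units S. r \<oplus>\<^bsub>S\<^esub> u \<in> Units S}"

definition ring_comm :: "('a, 'm) ring_scheme \<Rightarrow> 'a \<Rightarrow> 'a set" where
  "ring_comm S a = {x \<in> carrier S. a \<otimes>\<^bsub>S\<^esub> x = x \<otimes>\<^bsub>S\<^esub> a}"

definition ring_comm2 :: "('a, 'm) ring_scheme \<Rightarrow> 'a \<Rightarrow> 'a set" where
  "ring_comm2 S a = {y \<in> carrier S. \<forall>x \<in> ring_comm S a. x \<otimes>\<^bsub>S\<^esub> y = y \<otimes>\<^bsub>S\<^esub> x}"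

definition Delta_quasipolar_elem :: "('a, 'm) ring_scheme \<Rightarrow> 'a \<Rightarrow> bool" where
  "Delta_quasipolar_elem S a \<longleftrightarrow>
     (\<exists>p \<in> ring_comm2 S a. p \<otimes>\<^bsub>S\<^esub> p = p \<and> a \<oplus>\<^bsub>S\<^esub> p \<in> Delta S)"

definition Delta_quasipolar :: "('a, 'm) ring_scheme \<Rightarrow> bool" where
  "Delta_quasipolar S \<longleftrightarrow> (\<forall>a \<in> carrier S. Delta_quasipolar_elem S a)"

text \<open>
  The library's \<open>ring_mat\<close> takes entries from a type-class ring. Here the entries come from
  the carrier of a possibly noncommutative ring \<open>R\<close>, and the operations are computed
  with those of \<open>R\<close>.
\<close>
definition matrix_ring :: "nat \<Rightarrow> ('a, 'm) ring_scheme \<Rightarrow> 'a mat ring" where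
  "matrix_ring n R = \<lparr>
     carrier = {A \<in> carrier_mat n n. \<forall>i<n. \<forall>j<n. A $$ (i, j) \<in> carrier R},
     mult = (\<lambda>A B. mat n n (\<lambda>(i, j). \<Oplus>\<^bsub>R\<^esub>k\<in>{..<n}. A $$ (i, k) \<otimes>\<^bsub>R\<^esub> B $$ (k, j))),
     one = mat n n (\<lambda>(i, j). if i = j then \<one>\<^bsub>R\<^esub> else \<zero>\<^bsub>R\<^esub>),
     zero = mat n n (\<lambda>_. \<zero>\<^bsub>R\<^esub>),
     add = (\<lambda>A B. mat n n (\<lambda>(i, j). A $$ (i, j) \<oplus>\<^bsub>R\<^esub> B $$ (i, j)))\<rparr>"

end

theory Submission
  imports Defs "Jordan_Normal_Form.Missing_Ring"
begin

text \<open>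
  \<open>\<Delta>(S)\<close> is closed under differences and under multiplication by units, and contains no
  nonzero idempotent. In \<open>R[x]\<close>, suppose \<open>x + p \<in> \<Delta>\<close>. Since \<open>1 - 2p\<close> is a unit, so is \<open>v = x + 1 - p\<close>,
  and \<open>p v = p x\<close> gives \<open>p = p x v\<^sup>-\<^sup>1\<close>, which forces \<open>p = 0\<close> coefficient by coefficient. Then \<open>x + 1\<close>
  would be a unit, but its inverse would have all coefficients \<open>\<plusminus>1\<close>. In \<open>M\<^sub>n(R)\<close>, take \<open>a = E\<^sub>1\<^sub>2\<close> and
  suppose \<open>r = a + p \<in> \<Delta>\<close>. As \<open>1 + r\<close> and \<open>1 + a\<close> are units, \<open>r\<^sup>2\<close> and \<open>a r = a p\<close> lie in \<open>\<Delta>\<close>, hence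
  so does \<open>p = r\<^sup>2 - 2 a r\<close>. Thus \<open>p = 0\<close> and \<open>a \<in> \<Delta>\<close>, and then the nonzero idempotent
  \<open>E\<^sub>1\<^sub>2 E\<^sub>2\<^sub>1 = E\<^sub>1\<^sub>1\<close> lies in \<open>\<Delta>\<close>, a contradiction.
\<close>

section \<open>Units, \<Delta> and idempotents in an arbitrary ring\<close>

context ring
begin

text \<open>Cancels \<open>x\<close> against \<open>\<ominus> x\<close> when another summand stands
  between them, a shape that sorting sums by \<open>a_ac\<close> produces.\<close>

lemma a_cancel:
  assumes "x \<in> carrier R" "y \<in> carrier R"
  shows "x \<oplus> (y \<oplus> \<ominus> x) = y"
    and "z \<in> carrier R \<Longrightarrow> x \<oplus> (y \<oplus> (\<ominus> x \<oplus> z)) = y \<oplus> z"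
  using assms by (simp_all add: a_lcomm[of x y] r_neg r_neg2)

text \<open>The inverse is \<open>\<one> \<ominus> a\<close>.\<close>

lemma Units_add_square_zero:
  assumes "a \<in> carrier R" "a \<otimes> a = \<zero>"
  shows "\<one> \<oplus> a \<in> Units R"
proof -
  have "(\<one> \<oplus> a) \<otimes> (\<one> \<ominus> a) = \<one>" "(\<one> \<ominus> a) \<otimes> (\<one> \<oplus> a) = \<one>"
    using assms by (simp_all add: minus_eq l_distr r_distr l_minus r_minus a_ac r_neg r_neg1 r_neg2 a_cancel)
  then show ?thesis
    using assms unfolding Units_def by auto
qed

lemma Units_a_inv:
  assumes "u \<in> Units R"
  shows "\<ominus> u \<in> Units R"
proof -
  have "(\<ominus> u) \<otimes> (\<ominus> (inv u)) = \<one>" "(\<ominus> (inv u)) \<otimes> (\<ominus> u) = \<one>"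
    using assms by (simp_all add: l_minus r_minus Units_closed)
  then show ?thesis
    using assms unfolding Units_def by (auto intro!: bexI[of _ "\<ominus> (inv u)"] a_inv_closed Units_inv_closed[OF assms])
qed

lemma Delta_closed: "r \<in> Delta R \<Longrightarrow> r \<in> carrier R"
  by (simp add: Delta_def)

lemma Delta_add_Units: "r \<in> Delta R \<Longrightarrow> u \<in> Units R \<Longrightarrow> r \<oplus> u \<in> Units R"
  by (simp add: Delta_def)

text \<open>After \<open>u\<close> is factored out of \<open>u \<otimes> r \<oplus> v\<close>, the
  other factor is \<open>r\<close> plus a unit.\<close>

lemma Delta_Units_mult:
  assumes "r \<in> Delta R" "u \<in> Units R"
  shows "u \<otimes> r \<in> Delta R"
proof -
  have "u \<otimes> r \<oplus> v \<in> Units R" if v: "v \<in> Units R" for v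
  proof -
    have "u \<otimes> r \<oplus> v = u \<otimes> (r \<oplus> inv u \<otimes> v)"
      using assms v by (simp add: Delta_closed Units_closed r_distr m_assoc[symmetric])
    then show ?thesis
      using assms v by (auto intro!: Units_m_closed Delta_add_Units)
  qed
  then show ?thesis
    using assms by (simp add: Delta_def Units_closed)
qed

lemma Delta_mult_Units:
  assumes "r \<in> Delta R" "u \<in> Units R"
  shows "r \<otimes> u \<in> Delta R"
proof -
  have "r \<otimes> u \<oplus> v \<in> Units R" if v: "v \<in> Units R" for v
  proof -
    have "r \<otimes> u \<oplus> v = (r \<oplus> v \<otimes> inv u) \<otimes> u"
      using assms v by (simp add: Delta_closed Units_closed l_distr m_assoc)
    then show ?thesis
      using assms v by (auto intro!: Units_m_closed Delta_add_Units)
  qed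
  then show ?thesis
    using assms by (simp add: Delta_def Units_closed)
qed

text \<open>Units are closed under negation, so \<open>\<ominus> s \<oplus> u\<close> is the
  negative of the unit \<open>s \<oplus> \<ominus> u\<close>.\<close>

lemma Delta_minus:
  assumes "r \<in> Delta R" "s \<in> Delta R"
  shows "r \<ominus> s \<in> Delta R"
proof -
  have "r \<ominus> s \<oplus> u \<in> Units R" if u: "u \<in> Units R" for u
  proof -
    have "r \<ominus> s \<oplus> u = r \<oplus> \<ominus> (s \<oplus> \<ominus> u)"
      using assms u by (simp add: Delta_closed minus_eq minus_add a_assoc Units_closed)
    then show ?thesis
      using assms u by (auto intro!: Delta_add_Units Units_a_inv)
  qed
  then show ?thesis
    using assms by (simp add: Delta_def)
qed

text \<open>A partial ideal property: writing \<open>s\<close> as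
  \<open>(\<one> \<oplus> s) \<ominus> \<one>\<close> turns both products into differences of
  elements of \<open>Delta R\<close>.\<close>

lemma Delta_mult_of_Units_add_one:
  assumes "r \<in> Delta R" "s \<in> carrier R" "\<one> \<oplus> s \<in> Units R"
  shows "s \<otimes> r \<in> Delta R" and "r \<otimes> s \<in> Delta R"
proof -
  have "s \<otimes> r = (\<one> \<oplus> s) \<otimes> r \<ominus> r" "r \<otimes> s = r \<otimes> (\<one> \<oplus> s) \<ominus> r"
    using assms by (simp_all add: Delta_closed minus_eq l_distr r_distr a_ac r_neg r_neg1 r_neg2 a_cancel)
  then show "s \<otimes> r \<in> Delta R" "r \<otimes> s \<in> Delta R"
    using assms by (metis Delta_minus Delta_Units_mult Delta_mult_Units)+
qed

text \<open>Here \<open>e \<ominus> \<one>\<close> is a unit that \<open>e\<close>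
  annihilates.\<close>

lemma idempotent_Delta_eq_zero:
  assumes "e \<in> Delta R" "e \<otimes> e = e"
  shows "e = \<zero>"
proof -
  have c: "e \<in> carrier R" by (rule Delta_closed[OF assms(1)])
  have u: "e \<ominus> \<one> \<in> Units R"
    unfolding minus_eq by (rule Delta_add_Units[OF assms(1) Units_a_inv[OF Units_one_closed]])
  have "e = e \<otimes> ((e \<ominus> \<one>) \<otimes> inv (e \<ominus> \<one>))"
    using u c by simp
  also have "\<dots> = (e \<otimes> (e \<ominus> \<one>)) \<otimes> inv (e \<ominus> \<one>)"
    using u c by (simp add: m_assoc)
  also have "e \<otimes> (e \<ominus> \<one>) = \<zero>"
    using c assms(2) by (simp add: minus_eq r_distr r_minus r_neg)
  finally show ?thesis using u by simp
qed

text \<open>This element is its own inverse.\<close>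

lemma idempotent_reflection_Units:
  assumes "p \<in> carrier R" "p \<otimes> p = p"
  shows "\<one> \<ominus> (p \<oplus> p) \<in> Units R"
proof -
  have "(\<one> \<ominus> (p \<oplus> p)) \<otimes> (\<one> \<ominus> (p \<oplus> p)) = \<one>"
    using assms by (simp add: minus_eq l_distr r_distr l_minus r_minus minus_add a_ac r_neg r_neg1 r_neg2 a_cancel)
  then show ?thesis
    using assms unfolding Units_def by auto
qed

text \<open>Isolates what the matrix argument needs from the pair of matrix units \<open>a\<close> =
  E12, \<open>b\<close> = E21.\<close>

lemma not_Delta_quasipolar_of_square_zero:
  assumes a: "a \<in> carrier R" "a \<otimes> a = \<zero>" and b: "b \<in> carrier R" "b \<otimes> b = \<zero>"
    and ab: "(a \<otimes> b) \<otimes> (a \<otimes> b) = a \<otimes> b" "a \<otimes> b \<noteq> \<zero>"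
  shows "\<not> Delta_quasipolar R"
proof
  assume "Delta_quasipolar R"
  then obtain p where p: "p \<in> ring_comm2 R a" "p \<otimes> p = p" and r: "a \<oplus> p \<in> Delta R"
    using a(1) unfolding Delta_quasipolar_def Delta_quasipolar_elem_def by blast
  \<comment> \<open>\<open>a\<close> lies in its own commutant, so \<open>p\<close> commutes with
    it.\<close>
  have pc: "p \<in> carrier R" and ap: "a \<otimes> p = p \<otimes> a"
    using p(1) a(1) by (auto simp: ring_comm2_def ring_comm_def)
  have "\<one> \<oplus> (a \<oplus> p) \<in> Units R"
    using Delta_add_Units[OF r Units_one_closed] a(1) pc by (simp add: a_ac)
  then have rr: "(a \<oplus> p) \<otimes> (a \<oplus> p) \<in> Delta R"
    using Delta_mult_of_Units_add_one(1)[OF r] a(1) pc by simp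
  have ar: "a \<otimes> (a \<oplus> p) \<in> Delta R"
    by (rule Delta_mult_of_Units_add_one(1)[OF r a(1) Units_add_square_zero[OF a]])
  \<comment> \<open>With a^2 = 0 and ap = pa, the square expands to 2ap + p, and each subtracted
    term equals ap.\<close>
  have "p = (a \<oplus> p) \<otimes> (a \<oplus> p) \<ominus> a \<otimes> (a \<oplus> p) \<ominus> a \<otimes> (a \<oplus> p)"
    using a pc p(2) by (simp add: minus_eq l_distr r_distr ap[symmetric] a_ac r_neg r_neg1 r_neg2 a_cancel)
  with rr ar have "p \<in> Delta R"
    by (metis Delta_minus)
  then have "p = \<zero>"
    using p(2) by (rule idempotent_Delta_eq_zero)
  with r a have "a \<in> Delta R" by simp
  then have "a \<otimes> b \<in> Delta R"
    by (rule Delta_mult_of_Units_add_one(2)[OF _ b(1) Units_add_square_zero[OF b]])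
  with ab show False
    by (simp add: idempotent_Delta_eq_zero)
qed

end

section \<open>Polynomial rings\<close>

context UP_ring
begin

lemma coeff_mult_X_0:
  assumes "p \<in> carrier P"
  shows "coeff P (p \<otimes>\<^bsub>P\<^esub> monom P \<one> 1) 0 = \<zero>"
  using assms by simp

lemma coeff_mult_X_Suc:
  assumes "p \<in> carrier P"
  shows "coeff P (p \<otimes>\<^bsub>P\<^esub> monom P \<one> 1) (Suc n) = coeff P p n"
proof -
  have "coeff P (p \<otimes>\<^bsub>P\<^esub> monom P \<one> 1) (Suc n) =
      (\<Oplus>i\<in>{..Suc n}. if n = i then coeff P p i else \<zero>)"
    using assms by (auto simp del: R.finsum_Suc intro!: R.finsum_cong')
  also have "\<dots> = coeff P p n"
    using assms by (subst R.finsum_singleton) auto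
  finally show ?thesis .
qed

text \<open>Multiplication by X shifts degrees up, so the coefficient of degree \<open>n\<close> on
  the right of \<open>eq\<close> involves only coefficients of \<open>p\<close> of degree below
  \<open>n\<close>; strong induction applies.\<close>

lemma eq_mult_X_mult_imp_zero:
  assumes p: "p \<in> carrier P" and f: "f \<in> carrier P"
    and eq: "p = (p \<otimes>\<^bsub>P\<^esub> monom P \<one> 1) \<otimes>\<^bsub>P\<^esub> f"
  shows "p = \<zero>\<^bsub>P\<^esub>"
proof (rule up_eqI)
  fix n
  have "coeff P p n = \<zero>"
  proof (induction n rule: less_induct)
    case (less n)
    have "coeff P (p \<otimes>\<^bsub>P\<^esub> monom P \<one> 1) i = \<zero>" if "i \<le> n" for i
      using that p less by (cases i) (simp_all add: coeff_mult_X_0 coeff_mult_X_Suc del: coeff_mult One_nat_def)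
    then have "coeff P ((p \<otimes>\<^bsub>P\<^esub> monom P \<one> 1) \<otimes>\<^bsub>P\<^esub> f) n = \<zero>"
      using p f by (subst coeff_mult) (auto intro!: R.finsum_zero' simp del: coeff_mult One_nat_def)
    then show ?case
      by (subst eq)
  qed
  then show "coeff P p n = coeff P \<zero>\<^bsub>P\<^esub> n" by simp
qed (use p in simp_all)

text \<open>An inverse would satisfy f_0 = 1 and f_(k+1) = -f_k, so no coefficient could vanish,
  against finite support.\<close>

lemma X_add_one_not_Units:
  assumes "\<one> \<noteq> \<zero>"
  shows "monom P \<one> 1 \<oplus>\<^bsub>P\<^esub> \<one>\<^bsub>P\<^esub> \<notin> Units P"
proof
  assume "monom P \<one> 1 \<oplus>\<^bsub>P\<^esub> \<one>\<^bsub>P\<^esub> \<in> Units P"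
  \<comment> \<open>A left inverse is taken so that X multiplies \<open>f\<close> from the right, as
    in the shift lemmas.\<close>
  then obtain f where f: "f \<in> carrier P" and "f \<otimes>\<^bsub>P\<^esub> (monom P \<one> 1 \<oplus>\<^bsub>P\<^esub> \<one>\<^bsub>P\<^esub>) = \<one>\<^bsub>P\<^esub>"
    unfolding Units_def by blast
  then have eq: "f \<otimes>\<^bsub>P\<^esub> monom P \<one> 1 \<oplus>\<^bsub>P\<^esub> f = \<one>\<^bsub>P\<^esub>"
    by (simp add: P.r_distr)
  have coeffs: "coeff P (f \<otimes>\<^bsub>P\<^esub> monom P \<one> 1) k \<oplus> coeff P f k = (if k = 0 then \<one> else \<zero>)" for k
    using arg_cong[OF eq, of "\<lambda>q. coeff P q k"] f by (simp del: coeff_mult One_nat_def)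
  have f0: "coeff P f 0 = \<one>"
    using coeffs[of 0] f by (simp add: coeff_mult_X_0 del: coeff_mult One_nat_def)
  have f_Suc: "coeff P f k \<oplus> coeff P f (Suc k) = \<zero>" for k
    using coeffs[of "Suc k"] f by (simp add: coeff_mult_X_Suc del: coeff_mult One_nat_def)
  have nz: "coeff P f k \<noteq> \<zero>" for k
  proof (induction k)
    case 0
    then show ?case using f0 assms by simp
  next
    case (Suc k)
    then show ?case using f_Suc[of k] f by auto
  qed
  obtain n where "bound \<zero> n (coeff P f)"
    using f by (auto simp: P_def UP_def)
  then show False
    \<comment> \<open>\<open>bound\<close> makes the coefficients vanish strictly above
      \<open>n\<close>.\<close>
    using nz[of "Suc n"] by auto
qed

lemma not_Delta_quasipolar_UP:
  assumes "\<one> \<noteq> \<zero>"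
  shows "\<not> Delta_quasipolar P"
proof
  let ?x = "monom P \<one> 1"
  have x: "?x \<in> carrier P" by simp
  assume "Delta_quasipolar P"
  then obtain p where "p \<in> ring_comm2 P ?x" and pp: "p \<otimes>\<^bsub>P\<^esub> p = p"
    and r: "?x \<oplus>\<^bsub>P\<^esub> p \<in> Delta P"
    using x unfolding Delta_quasipolar_def Delta_quasipolar_elem_def by blast
  then have p: "p \<in> carrier P" by (simp add: ring_comm2_def)
  \<comment> \<open>This is x + 1 - p, written as an element of \<Delta> plus the unit 1 -
    2p.\<close>
  let ?v = "?x \<oplus>\<^bsub>P\<^esub> p \<oplus>\<^bsub>P\<^esub> (\<one>\<^bsub>P\<^esub> \<ominus>\<^bsub>P\<^esub> (p \<oplus>\<^bsub>P\<^esub> p))"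
  have v: "?v \<in> Units P"
    by (rule P.Delta_add_Units[OF r P.idempotent_reflection_Units[OF p pp]])
  \<comment> \<open>The remaining terms p^2 + p - 2p cancel because p^2 = p.\<close>
  have "p \<otimes>\<^bsub>P\<^esub> ?v = p \<otimes>\<^bsub>P\<^esub> ?x"
    using p x pp by (simp add: P.minus_eq P.r_distr P.r_minus P.minus_add P.a_ac
        P.r_neg P.r_neg1 P.r_neg2 P.a_cancel del: One_nat_def)
  then have "p = (p \<otimes>\<^bsub>P\<^esub> ?x) \<otimes>\<^bsub>P\<^esub> inv\<^bsub>P\<^esub> ?v"
    using p v by (metis P.Units_closed P.Units_inv_closed P.Units_r_inv P.m_assoc P.r_one)
  then have "p = \<zero>\<^bsub>P\<^esub>"
    using p v by (intro eq_mult_X_mult_imp_zero[of p "inv\<^bsub>P\<^esub> ?v"]) auto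
  with r x have "?x \<in> Delta P" by simp
  then have "?x \<oplus>\<^bsub>P\<^esub> \<one>\<^bsub>P\<^esub> \<in> Units P"
    by (rule P.Delta_add_Units[OF _ P.Units_one_closed])
  with X_add_one_not_Units[OF assms] show False by contradiction
qed

end

section \<open>Matrix rings over a possibly noncommutative ring\<close>

context ring
begin

lemma matrix_ring_carrier:
  "A \<in> carrier (matrix_ring n R) \<longleftrightarrow>
    A \<in> carrier_mat n n \<and> (\<forall>i<n. \<forall>j<n. A $$ (i, j) \<in> carrier R)"
  by (simp add: matrix_ring_def)

lemma matrix_ring_index [simp]:
  assumes "i < n" "j < n"
  shows "(A \<otimes>\<^bsub>matrix_ring n R\<^esub> B) $$ (i, j) = (\<Oplus>k\<in>{..<n}. A $$ (i, k) \<otimes> B $$ (k, j))"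
    and "(A \<oplus>\<^bsub>matrix_ring n R\<^esub> B) $$ (i, j) = A $$ (i, j) \<oplus> B $$ (i, j)"
    and "\<one>\<^bsub>matrix_ring n R\<^esub> $$ (i, j) = (if i = j then \<one> else \<zero>)"
    and "\<zero>\<^bsub>matrix_ring n R\<^esub> $$ (i, j) = \<zero>"
  using assms by (simp_all add: matrix_ring_def)

lemma matrix_ring_closed:
  shows "A \<in> carrier (matrix_ring n R) \<Longrightarrow> B \<in> carrier (matrix_ring n R) \<Longrightarrow>
      A \<otimes>\<^bsub>matrix_ring n R\<^esub> B \<in> carrier (matrix_ring n R)"
    and "A \<in> carrier (matrix_ring n R) \<Longrightarrow> B \<in> carrier (matrix_ring n R) \<Longrightarrow>
      A \<oplus>\<^bsub>matrix_ring n R\<^esub> B \<in> carrier (matrix_ring n R)"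
    and "\<one>\<^bsub>matrix_ring n R\<^esub> \<in> carrier (matrix_ring n R)"
    and "\<zero>\<^bsub>matrix_ring n R\<^esub> \<in> carrier (matrix_ring n R)"
  by (auto simp: matrix_ring_def intro!: finsum_closed)

lemma matrix_ring_eqI:
  assumes "A \<in> carrier (matrix_ring n R)" "B \<in> carrier (matrix_ring n R)"
    and "\<And>i j. i < n \<Longrightarrow> j < n \<Longrightarrow> A $$ (i, j) = B $$ (i, j)"
  shows "A = B"
  using assms by (intro eq_matI) (auto simp: matrix_ring_carrier)

text \<open>Each entry of either side is a double sum of triple products; the two differ by the
  order of summation and the bracketing.\<close>

lemma matrix_ring_m_assoc:
  assumes "A \<in> carrier (matrix_ring n R)" "B \<in> carrier (matrix_ring n R)"
    "C \<in> carrier (matrix_ring n R)"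
  shows "A \<otimes>\<^bsub>matrix_ring n R\<^esub> B \<otimes>\<^bsub>matrix_ring n R\<^esub> C =
    A \<otimes>\<^bsub>matrix_ring n R\<^esub> (B \<otimes>\<^bsub>matrix_ring n R\<^esub> C)"
proof (rule matrix_ring_eqI)
  fix i j assume ij: "i < n" "j < n"
  have c: "A $$ (k, l) \<in> carrier R" "B $$ (k, l) \<in> carrier R" "C $$ (k, l) \<in> carrier R"
    if "k < n" "l < n" for k l
    using assms that by (simp_all add: matrix_ring_carrier)
  have "(A \<otimes>\<^bsub>matrix_ring n R\<^esub> B \<otimes>\<^bsub>matrix_ring n R\<^esub> C) $$ (i, j) =
      (\<Oplus>k\<in>{..<n}. (\<Oplus>l\<in>{..<n}. A $$ (i, l) \<otimes> B $$ (l, k)) \<otimes> C $$ (k, j))"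
    using ij c by (auto intro!: finsum_cong' finsum_closed)
  also have "\<dots> = (\<Oplus>k\<in>{..<n}. \<Oplus>l\<in>{..<n}. A $$ (i, l) \<otimes> B $$ (l, k) \<otimes> C $$ (k, j))"
    using ij c by (intro finsum_cong' finsum_ldistr) (auto intro!: finsum_closed)
  also have "\<dots> = (\<Oplus>l\<in>{..<n}. \<Oplus>k\<in>{..<n}. A $$ (i, l) \<otimes> B $$ (l, k) \<otimes> C $$ (k, j))"
    using ij c by (intro finsum_finsum_swap) auto
  also have "\<dots> = (\<Oplus>l\<in>{..<n}. \<Oplus>k\<in>{..<n}. A $$ (i, l) \<otimes> (B $$ (l, k) \<otimes> C $$ (k, j)))"
    using ij c by (intro finsum_cong') (auto simp: m_assoc intro!: finsum_closed)
  also have "\<dots> = (\<Oplus>l\<in>{..<n}. A $$ (i, l) \<otimes> (\<Oplus>k\<in>{..<n}. B $$ (l, k) \<otimes> C $$ (k, j)))"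
    using ij c by (intro finsum_cong' finsum_rdistr[symmetric]) (auto intro!: finsum_closed)
  also have "\<dots> = (A \<otimes>\<^bsub>matrix_ring n R\<^esub> (B \<otimes>\<^bsub>matrix_ring n R\<^esub> C)) $$ (i, j)"
    using ij c by (auto intro!: finsum_cong' finsum_closed)
  finally show "(A \<otimes>\<^bsub>matrix_ring n R\<^esub> B \<otimes>\<^bsub>matrix_ring n R\<^esub> C) $$ (i, j) =
    (A \<otimes>\<^bsub>matrix_ring n R\<^esub> (B \<otimes>\<^bsub>matrix_ring n R\<^esub> C)) $$ (i, j)" .
qed (intro matrix_ring_closed assms)+

text \<open>Only one term survives. The tests \<open>i = k\<close> and \<open>k = i\<close> are
  oriented like the entries of the identity matrix as left and right factor.\<close>

lemma finsum_delta_mult: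
  assumes "finite I" "i \<in> I" "f \<in> I \<rightarrow> carrier R"
  shows "(\<Oplus>k\<in>I. (if i = k then \<one> else \<zero>) \<otimes> f k) = f i"
    and "(\<Oplus>k\<in>I. f k \<otimes> (if k = i then \<one> else \<zero>)) = f i"
proof -
  have "(\<Oplus>k\<in>I. (if i = k then \<one> else \<zero>) \<otimes> f k) = (\<Oplus>k\<in>I. if i = k then f k else \<zero>)"
    "(\<Oplus>k\<in>I. f k \<otimes> (if k = i then \<one> else \<zero>)) = (\<Oplus>k\<in>I. if i = k then f k else \<zero>)"
    using assms by (auto simp: Pi_iff intro!: finsum_cong')
  then show "(\<Oplus>k\<in>I. (if i = k then \<one> else \<zero>) \<otimes> f k) = f i"
    "(\<Oplus>k\<in>I. f k \<otimes> (if k = i then \<one> else \<zero>)) = f i"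
    using finsum_singleton[OF assms(2,1,3)] by simp_all
qed

text \<open>The axioms are checked entrywise; this makes the results on arbitrary rings available
  for matrices.\<close>

lemma ring_matrix_ring: "ring (matrix_ring n R)"
proof (intro ringI abelian_groupI monoidI)
  fix A assume A: "A \<in> carrier (matrix_ring n R)"
  note c = A[unfolded matrix_ring_carrier]
  show "\<one>\<^bsub>matrix_ring n R\<^esub> \<otimes>\<^bsub>matrix_ring n R\<^esub> A = A"
  proof (rule matrix_ring_eqI)
    fix i j assume ij: "i < n" "j < n"
    have "(\<one>\<^bsub>matrix_ring n R\<^esub> \<otimes>\<^bsub>matrix_ring n R\<^esub> A) $$ (i, j) =
        (\<Oplus>k\<in>{..<n}. (if i = k then \<one> else \<zero>) \<otimes> A $$ (k, j))"
      using ij c by (auto intro!: finsum_cong')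
    also have "\<dots> = A $$ (i, j)"
      using ij c by (intro finsum_delta_mult(1)) auto
    finally show "(\<one>\<^bsub>matrix_ring n R\<^esub> \<otimes>\<^bsub>matrix_ring n R\<^esub> A) $$ (i, j) = A $$ (i, j)" .
  qed (intro matrix_ring_closed A)+
  show "A \<otimes>\<^bsub>matrix_ring n R\<^esub> \<one>\<^bsub>matrix_ring n R\<^esub> = A"
  proof (rule matrix_ring_eqI)
    fix i j assume ij: "i < n" "j < n"
    have "(A \<otimes>\<^bsub>matrix_ring n R\<^esub> \<one>\<^bsub>matrix_ring n R\<^esub>) $$ (i, j) =
        (\<Oplus>k\<in>{..<n}. A $$ (i, k) \<otimes> (if k = j then \<one> else \<zero>))"
      using ij c by (auto intro!: finsum_cong')
    also have "\<dots> = A $$ (i, j)"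
      using ij c by (intro finsum_delta_mult(2)) auto
    finally show "(A \<otimes>\<^bsub>matrix_ring n R\<^esub> \<one>\<^bsub>matrix_ring n R\<^esub>) $$ (i, j) = A $$ (i, j)" .
  qed (intro matrix_ring_closed A)+
  show "\<zero>\<^bsub>matrix_ring n R\<^esub> \<oplus>\<^bsub>matrix_ring n R\<^esub> A = A"
    using c by (intro matrix_ring_eqI[of _ n] matrix_ring_closed A) auto
  have neg: "mat n n (\<lambda>(i, j). \<ominus> (A $$ (i, j))) \<in> carrier (matrix_ring n R)"
    using c by (auto simp: matrix_ring_carrier)
  show "\<exists>B\<in>carrier (matrix_ring n R). B \<oplus>\<^bsub>matrix_ring n R\<^esub> A = \<zero>\<^bsub>matrix_ring n R\<^esub>"
    using c by (intro bexI[OF _ neg] matrix_ring_eqI[of _ n] matrix_ring_closed neg A)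
      (auto simp: l_neg)
  fix B assume B: "B \<in> carrier (matrix_ring n R)"
  show "A \<oplus>\<^bsub>matrix_ring n R\<^esub> B = B \<oplus>\<^bsub>matrix_ring n R\<^esub> A"
    using c B by (intro matrix_ring_eqI[of _ n] matrix_ring_closed A B)
      (auto simp: matrix_ring_carrier a_comm)
  fix C assume C: "C \<in> carrier (matrix_ring n R)"
  have c: "A $$ (k, l) \<in> carrier R" "B $$ (k, l) \<in> carrier R" "C $$ (k, l) \<in> carrier R"
    if "k < n" "l < n" for k l
    using A B C that by (simp_all add: matrix_ring_carrier)
  show "A \<oplus>\<^bsub>matrix_ring n R\<^esub> B \<oplus>\<^bsub>matrix_ring n R\<^esub> C =
      A \<oplus>\<^bsub>matrix_ring n R\<^esub> (B \<oplus>\<^bsub>matrix_ring n R\<^esub> C)"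
    by (intro matrix_ring_eqI[of _ n] matrix_ring_closed A B C) (simp add: a_assoc c)
  show "(A \<oplus>\<^bsub>matrix_ring n R\<^esub> B) \<otimes>\<^bsub>matrix_ring n R\<^esub> C =
      A \<otimes>\<^bsub>matrix_ring n R\<^esub> C \<oplus>\<^bsub>matrix_ring n R\<^esub> B \<otimes>\<^bsub>matrix_ring n R\<^esub> C"
  proof (rule matrix_ring_eqI)
    fix i j assume ij: "i < n" "j < n"
    have "((A \<oplus>\<^bsub>matrix_ring n R\<^esub> B) \<otimes>\<^bsub>matrix_ring n R\<^esub> C) $$ (i, j) =
        (\<Oplus>k\<in>{..<n}. A $$ (i, k) \<otimes> C $$ (k, j) \<oplus> B $$ (i, k) \<otimes> C $$ (k, j))"
      using ij c by (auto simp: l_distr simp del: finsum_addf intro!: finsum_cong')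
    also have "\<dots> = (\<Oplus>k\<in>{..<n}. A $$ (i, k) \<otimes> C $$ (k, j)) \<oplus>
        (\<Oplus>k\<in>{..<n}. B $$ (i, k) \<otimes> C $$ (k, j))"
      using ij c by (intro finsum_addf) auto
    finally show "((A \<oplus>\<^bsub>matrix_ring n R\<^esub> B) \<otimes>\<^bsub>matrix_ring n R\<^esub> C) $$ (i, j) =
        (A \<otimes>\<^bsub>matrix_ring n R\<^esub> C \<oplus>\<^bsub>matrix_ring n R\<^esub> B \<otimes>\<^bsub>matrix_ring n R\<^esub> C) $$ (i, j)"
      using ij by simp
  qed (intro matrix_ring_closed A B C)+
  show "C \<otimes>\<^bsub>matrix_ring n R\<^esub> (A \<oplus>\<^bsub>matrix_ring n R\<^esub> B) =
      C \<otimes>\<^bsub>matrix_ring n R\<^esub> A \<oplus>\<^bsub>matrix_ring n R\<^esub> C \<otimes>\<^bsub>matrix_ring n R\<^esub> B"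
  proof (rule matrix_ring_eqI)
    fix i j assume ij: "i < n" "j < n"
    have "(C \<otimes>\<^bsub>matrix_ring n R\<^esub> (A \<oplus>\<^bsub>matrix_ring n R\<^esub> B)) $$ (i, j) =
        (\<Oplus>k\<in>{..<n}. C $$ (i, k) \<otimes> A $$ (k, j) \<oplus> C $$ (i, k) \<otimes> B $$ (k, j))"
      using ij c by (auto simp: r_distr simp del: finsum_addf intro!: finsum_cong')
    also have "\<dots> = (\<Oplus>k\<in>{..<n}. C $$ (i, k) \<otimes> A $$ (k, j)) \<oplus>
        (\<Oplus>k\<in>{..<n}. C $$ (i, k) \<otimes> B $$ (k, j))"
      using ij c by (intro finsum_addf) auto
    finally show "(C \<otimes>\<^bsub>matrix_ring n R\<^esub> (A \<oplus>\<^bsub>matrix_ring n R\<^esub> B)) $$ (i, j) =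
        (C \<otimes>\<^bsub>matrix_ring n R\<^esub> A \<oplus>\<^bsub>matrix_ring n R\<^esub> C \<otimes>\<^bsub>matrix_ring n R\<^esub> B) $$ (i, j)"
      using ij by simp
  qed (intro matrix_ring_closed A B C)+
qed (intro matrix_ring_closed matrix_ring_m_assoc; assumption)+

text \<open>Indices start at 0, so E12 is \<open>matrix_unit n 0 1\<close>. An index
  \<open>r\<close> or \<open>s\<close> outside the range below \<open>n\<close> gives the zero
  matrix.\<close>

definition matrix_unit :: "nat \<Rightarrow> nat \<Rightarrow> nat \<Rightarrow> 'a mat" where
  "matrix_unit n r s = mat n n (\<lambda>(i, j). if i = r \<and> j = s then \<one> else \<zero>)"

lemma matrix_unit_closed: "matrix_unit n r s \<in> carrier (matrix_ring n R)"
  by (simp add: matrix_unit_def matrix_ring_carrier)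

text \<open>The bound \<open>s < n\<close> puts the inner index within the range of
  summation.\<close>

lemma matrix_unit_mult:
  assumes "s < n"
  shows "matrix_unit n r s \<otimes>\<^bsub>matrix_ring n R\<^esub> matrix_unit n t u =
    (if s = t then matrix_unit n r u else \<zero>\<^bsub>matrix_ring n R\<^esub>)"
proof (rule matrix_ring_eqI)
  fix i j assume ij: "i < n" "j < n"
  \<comment> \<open>The row test \<open>i = r\<close> of the left factor is moved into
    \<open>?f\<close>, leaving a pure delta in \<open>k\<close> for
    \<open>finsum_delta_mult\<close>.\<close>
  let ?f = "\<lambda>k. if i = r \<and> k = t \<and> j = u then \<one> else \<zero>"
  have "(matrix_unit n r s \<otimes>\<^bsub>matrix_ring n R\<^esub> matrix_unit n t u) $$ (i, j) =
      (\<Oplus>k\<in>{..<n}. (if s = k then \<one> else \<zero>) \<otimes> ?f k)"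
    using ij by (auto simp: matrix_unit_def intro!: finsum_cong')
  also have "\<dots> = ?f s"
    using assms by (intro finsum_delta_mult(1)) auto
  also have "\<dots> = (if s = t then matrix_unit n r u else \<zero>\<^bsub>matrix_ring n R\<^esub>) $$ (i, j)"
    using ij by (simp add: matrix_unit_def)
  finally show "(matrix_unit n r s \<otimes>\<^bsub>matrix_ring n R\<^esub> matrix_unit n t u) $$ (i, j) =
    (if s = t then matrix_unit n r u else \<zero>\<^bsub>matrix_ring n R\<^esub>) $$ (i, j)" .
qed (auto intro!: matrix_ring_closed matrix_unit_closed)

lemma not_Delta_quasipolar_matrix_ring:
  assumes "\<one> \<noteq> \<zero>" "n \<ge> 2"
  shows "\<not> Delta_quasipolar (matrix_ring n R)"
proof -
  interpret M: ring "matrix_ring n R" by (rule ring_matrix_ring)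
  \<comment> \<open>The product E12 E21 = E11 is nonzero because its corner entry is
    \<open>\<one>\<close>.\<close>
  have "matrix_unit n 0 0 $$ (0, 0) \<noteq> \<zero>\<^bsub>matrix_ring n R\<^esub> $$ (0, 0)"
    using assms by (simp add: matrix_unit_def)
  then have "matrix_unit n 0 0 \<noteq> \<zero>\<^bsub>matrix_ring n R\<^esub>" by metis
  then show ?thesis
    using assms(2)
    by (intro M.not_Delta_quasipolar_of_square_zero[of "matrix_unit n 0 1" "matrix_unit n 1 0"])
      (simp_all add: matrix_unit_closed matrix_unit_mult)
qed

end

text \<open>The assumption \<open>\<one> \<noteq> \<zero>\<close> excludes the zero ring, over which
  polynomials and matrices again form zero rings, and a zero ring is \<Delta>-quasipolar.\<close>

theorem proposition2p25:
  fixes R :: "('a, 'm) ring_scheme" (structure)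
  assumes "ring R" and "\<one> \<noteq> \<zero>"
  shows "\<not> Delta_quasipolar (UP R) \<and> (\<forall>n\<ge>2. \<not> Delta_quasipolar (matrix_ring n R))"
proof -
  interpret ring R by fact
  interpret UP: UP_ring R "UP R" by unfold_locales simp
  show ?thesis
    using UP.not_Delta_quasipolar_UP[OF assms(2)] not_Delta_quasipolar_matrix_ring[OF assms(2)]
    by blast
qed

end
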